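(* Let $(B,\cdot,\circ)$ be a skew left brace and let $(B,\lambda,\rho)$ be its associated solution. The following are equivalent: (i) $(B,\lambda,\rho)$ is $2$-reductive; (ii) $\lambda_{a\cdot b}=\lambda_{b\cdot a}=\lambda_{a\circ b}$ and $\rho_{a\cdot b}=\rho_{b\cdot a}=\rho_{a\circ b}$ for all $a,b\in B$; (iii) $(B,\lambda,\rho)$ is of multipermutation level at most $2$; (iv) $(B,\cdot,\circ)$ is nilpotent of class at most $2$; (v) the opposite skew left brace $(B,\cdot_{op},\circ)$ is nilpotent of class at most $2$.
   Context: A skew left brace is $(B,\cdot,\circ)$ with $(B,\cdot)$ and $(B,\circ)$ groups such that $a\circ(b\cdot c)=(a\circ b)\cdot a^{-1}\cdot(a\circ c)$ for all $a,b,c$; $a^{-1}$ is the inverse in $(B,\cdot)$, $\bar a$ the inverse in $(B,\circ)$ (both groups share the neutral element $1$). Put $\lambda_a(b)=a^{-1}\cdot(a\circ b)$ and $\rho_b(a)=\overline{\lambda_a(b)}\circ a\circ b$; the associated solution is $(B,\lambda,\rho)$, i.e. $r(a,b)=(\lambda_a(b),\rho_b(a))$, which is a solution. A solution is a triple $(X,\sigma,\tau)$ with bijections $\sigma_x,\tau_y$ of $X$ such that $r(x,y)=(\sigma_x(y),\tau_y(x))$ is a bijection of $X^2$ satisfying $(\mathrm{id}\times r)(r\times\mathrm{id})(\mathrm{id}\times r)=(r\times\mathrm{id})(\mathrm{id}\times r)(r\times\mathrm{id})$. It is $2$-reductive if $\sigma_{\sigma_x(y)}=\sigma_y$, $\tau_{\tau_x(y)}=\tau_y$,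 $\sigma_{\tau_x(y)}=\sigma_y$, $\tau_{\sigma_x(y)}=\tau_y$ for all $x,y$. For a solution, $x\approx y$ iff $\sigma_x=\sigma_y$ and $\tau_x=\tau_y$; this is a congruence and induces the retraction solution $\mathrm{Ret}(X)$ on $X/{\approx}$ by $\sigma_{[x]}([y])=[\sigma_x(y)]$, $\tau_{[y]}([x])=[\tau_y(x)]$. The solution has multipermutation level at most $2$ if $\mathrm{Ret}(\mathrm{Ret}(X))$ has one element. The socle is $\mathrm{Soc}(B)=\{a\in B: a\circ b=a\cdot b=b\cdot a\ \forall b\in B\}$, an ideal (normal in both groups and $\lambda$-invariant), so $B/\mathrm{Soc}(B)$ is a skew left brace; with $B_0=B$, $B_{n+1}=B_n/\mathrm{Soc}(B_n)$, $B$ is nilpotent of class at most $2$ if $|B_2|=1$. The opposite skew left brace is $(B,\cdot_{op},\circ)$ with $a\cdot_{op}b=b\cdot a$. *)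

theory Defs
  imports "HOL-Algebra.Algebra"
begin

section \<open>Set-theoretic solutions of the Yang--Baxter equation\<close>

text \<open>For \<open>S = \<lparr>pts = X, sig = \<sigma>, tau = \<tau>\<rparr>\<close> we write \<open>sig S x y\<close> for \<open>\<sigma>\<^sub>x(y)\<close> and
  \<open>tau S y x\<close> for \<open>\<tau>\<^sub>y(x)\<close>: the index of the map always comes first.\<close>

record 'a yb_data =
  pts :: "'a set"
  sig :: "'a \<Rightarrow> 'a \<Rightarrow> 'a"
  tau :: "'a \<Rightarrow> 'a \<Rightarrow> 'a"

definition yb_map :: "'a yb_data \<Rightarrow> 'a \<times> 'a \<Rightarrow> 'a \<times> 'a" where
  "yb_map S = (\<lambda>(x, y). (sig S x y, tau S y x))"

definition yb_left :: "'a yb_data \<Rightarrow> 'a \<times> 'a \<times> 'a \<Rightarrow> 'a \<times> 'a \<times> 'a" where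
  "yb_left S = (\<lambda>(x, y, z). let (u, v) = yb_map S (x, y) in (u, v, z))"

definition yb_right :: "'a yb_data \<Rightarrow> 'a \<times> 'a \<times> 'a \<Rightarrow> 'a \<times> 'a \<times> 'a" where
  "yb_right S = (\<lambda>(x, y, z). let (u, v) = yb_map S (y, z) in (x, u, v))"

definition yb_solution :: "'a yb_data \<Rightarrow> bool" where
  "yb_solution S \<longleftrightarrow>
     (\<forall>x\<in>pts S. bij_betw (sig S x) (pts S) (pts S) \<and> bij_betw (tau S x) (pts S) (pts S)) \<and>
     bij_betw (yb_map S) (pts S \<times> pts S) (pts S \<times> pts S) \<and>
     (\<forall>t \<in> pts S \<times> pts S \<times> pts S.
        yb_right S (yb_left S (yb_right S t)) = yb_left S (yb_right S (yb_left S t)))"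

definition two_reductive :: "'a yb_data \<Rightarrow> bool" where
  "two_reductive S \<longleftrightarrow>
     (\<forall>x\<in>pts S. \<forall>y\<in>pts S. \<forall>z\<in>pts S.
        sig S (sig S x y) z = sig S y z \<and>
        tau S (tau S x y) z = tau S y z \<and>
        sig S (tau S x y) z = sig S y z \<and>
        tau S (sig S x y) z = tau S y z)"

definition ret_rel :: "'a yb_data \<Rightarrow> ('a \<times> 'a) set" where
  "ret_rel S = {(x, y). x \<in> pts S \<and> y \<in> pts S \<and>
     (\<forall>z\<in>pts S. sig S x z = sig S y z \<and> tau S x z = tau S y z)}"

text \<open>The maps induced on equivalence classes are written as in
  \<^theory>\<open>HOL.Equiv_Relations\<close>, as the union of the classes of all values on representatives; since
  the relation is a congruence, this is the class of the value on any pair of representatives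
  (lemmas \<open>sig_Ret\<close> and \<open>tau_Ret\<close> below).\<close>

definition Ret :: "'a yb_data \<Rightarrow> 'a set yb_data" where
  "Ret S = \<lparr>pts = pts S // ret_rel S,
     sig = (\<lambda>P Q. \<Union>x\<in>P. \<Union>y\<in>Q. ret_rel S `` {sig S x y}),
     tau = (\<lambda>Q P. \<Union>y\<in>Q. \<Union>x\<in>P. ret_rel S `` {tau S y x})\<rparr>"

definition mpl_le_2 :: "'a yb_data \<Rightarrow> bool" where
  "mpl_le_2 S \<longleftrightarrow> card (pts (Ret (Ret S))) = 1"

lemma equiv_ret_rel: "equiv (pts S) (ret_rel S)"
  by (rule equivI) (auto simp: ret_rel_def refl_on_def sym_def trans_def)

lemma yb_solution_closed:
  assumes "yb_solution S" "x \<in> pts S" "y \<in> pts S"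
  shows "sig S x y \<in> pts S" "tau S x y \<in> pts S"
  using assms by (auto simp: yb_solution_def bij_betw_def)

lemma yb_solution_braid:
  assumes "yb_solution S" "x \<in> pts S" "y \<in> pts S" "z \<in> pts S"
  shows "sig S (sig S x y) (sig S (tau S y x) z) = sig S x (sig S y z)"
    and "tau S (tau S z y) (tau S (sig S y z) x) = tau S z (tau S y x)"
proof -
  have "yb_right S (yb_left S (yb_right S (x, y, z))) = yb_left S (yb_right S (yb_left S (x, y, z)))"
    using assms unfolding yb_solution_def by blast
  then show "sig S (sig S x y) (sig S (tau S y x) z) = sig S x (sig S y z)"
    and "tau S (tau S z y) (tau S (sig S y z) x) = tau S z (tau S y x)"
    by (simp_all add: yb_left_def yb_right_def yb_map_def)
qed

lemma ret_rel_sig_tau: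
  assumes S: "yb_solution S" and "(x, x') \<in> ret_rel S" "(y, y') \<in> ret_rel S"
  shows "(sig S x y, sig S x' y') \<in> ret_rel S" "(tau S x y, tau S x' y') \<in> ret_rel S"
proof -
  note cl = yb_solution_closed[OF S]
  have X: "x \<in> pts S" "x' \<in> pts S" "y \<in> pts S" "y' \<in> pts S"
    and ex: "\<And>z. z \<in> pts S \<Longrightarrow> sig S x z = sig S x' z \<and> tau S x z = tau S x' z"
    and ey: "\<And>z. z \<in> pts S \<Longrightarrow> sig S y z = sig S y' z \<and> tau S y z = tau S y' z"
    using assms(2,3) by (auto simp: ret_rel_def)
  have surj: "\<exists>w\<in>pts S. sig S a w = z" "\<exists>w\<in>pts S. tau S a w = z" if "a \<in> pts S" "z \<in> pts S" for a z
  proof -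
    have "sig S a ` pts S = pts S" "tau S a ` pts S = pts S"
      using S that(1) unfolding yb_solution_def bij_betw_def by blast+
    then show "\<exists>w\<in>pts S. sig S a w = z" "\<exists>w\<in>pts S. tau S a w = z"
      using that(2) by (metis imageE)+
  qed
  have inj: "u = v" if uv: "tau S a u = tau S a v \<or> sig S a u = sig S a v"
      "a \<in> pts S" "u \<in> pts S" "v \<in> pts S" for a u v
  proof -
    have "inj_on (tau S a) (pts S)" "inj_on (sig S a) (pts S)"
      using S uv(2) unfolding yb_solution_def bij_betw_def by blast+
    then show ?thesis using uv unfolding inj_on_def by blast
  qed
  have 1: "sig S (sig S x y) z = sig S (sig S x y') z" if z: "z \<in> pts S" for z
  proof -
    obtain w where w: "w \<in> pts S" "sig S (tau S y x) w = z"
      using surj(1)[OF cl(2)[OF X(3,1)] z] by blast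
    show ?thesis
      using yb_solution_braid(1)[OF S, of x y w] yb_solution_braid(1)[OF S, of x y' w] w X ey by auto
  qed
  have 2: "tau S (sig S x y) z = tau S (sig S x y') z" if z: "z \<in> pts S" for z
  proof (rule inj)
    show "tau S (tau S y x) (tau S (sig S x y) z) = tau S (tau S y x) (tau S (sig S x y') z) \<or>
        sig S (tau S y x) (tau S (sig S x y) z) = sig S (tau S y x) (tau S (sig S x y') z)"
      using yb_solution_braid(2)[OF S z X(1) X(3)] yb_solution_braid(2)[OF S z X(1) X(4)]
        ey[OF X(1)] ey[OF cl(2)[OF X(1) z]] by simp
  qed (use X z cl in auto)
  have 3: "tau S (tau S x y) z = tau S (tau S x y') z" if z: "z \<in> pts S" for z
  proof -
    obtain w where w: "w \<in> pts S" "tau S (sig S y x) w = z"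
      using surj(2)[OF cl(1)[OF X(3,1)] z] by blast
    show ?thesis
      using yb_solution_braid(2)[OF S, of w y x] yb_solution_braid(2)[OF S, of w y' x] w X ey by auto
  qed
  have 4: "sig S (tau S x y) z = sig S (tau S x y') z" if z: "z \<in> pts S" for z
  proof (rule inj)
    show "tau S (sig S y x) (sig S (tau S x y) z) = tau S (sig S y x) (sig S (tau S x y') z) \<or>
        sig S (sig S y x) (sig S (tau S x y) z) = sig S (sig S y x) (sig S (tau S x y') z)"
      using yb_solution_braid(1)[OF S X(3) X(1) z] yb_solution_braid(1)[OF S X(4) X(1) z]
        ey[OF X(1)] ey[OF cl(1)[OF X(1) z]] by simp
  qed (use X z cl in auto)
  show "(sig S x y, sig S x' y') \<in> ret_rel S" "(tau S x y, tau S x' y') \<in> ret_rel S"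
    using 1 2 3 4 ex X cl by (auto simp: ret_rel_def)
qed

lemma sig_Ret:
  assumes "yb_solution S" "x \<in> pts S" "y \<in> pts S"
  shows "sig (Ret S) (ret_rel S `` {x}) (ret_rel S `` {y}) = ret_rel S `` {sig S x y}"
proof -
  have "congruent2 (ret_rel S) (ret_rel S) (\<lambda>x y. ret_rel S `` {sig S x y})"
    by (intro congruent2I') (simp add: equiv_class_eq[OF equiv_ret_rel] ret_rel_sig_tau assms(1))
  from UN_equiv_class2[OF equiv_ret_rel equiv_ret_rel this assms(2,3)]
  show ?thesis by (simp add: Ret_def)
qed

lemma tau_Ret:
  assumes "yb_solution S" "x \<in> pts S" "y \<in> pts S"
  shows "tau (Ret S) (ret_rel S `` {y}) (ret_rel S `` {x}) = ret_rel S `` {tau S y x}"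
proof -
  have "congruent2 (ret_rel S) (ret_rel S) (\<lambda>y x. ret_rel S `` {tau S y x})"
    by (intro congruent2I') (simp add: equiv_class_eq[OF equiv_ret_rel] ret_rel_sig_tau assms(1))
  from UN_equiv_class2[OF equiv_ret_rel equiv_ret_rel this assms(3,2)]
  show ?thesis by (simp add: Ret_def)
qed


section \<open>Skew left braces\<close>

record 'a brace_data =
  dotg :: "'a monoid"
  circg :: "'a monoid"

locale skew_left_brace = dot: group "dotg B" + circ: group "circg B" for B :: "'a brace_data" +
  assumes carrier_eq: "carrier (circg B) = carrier (dotg B)"
    and brace_law: "\<lbrakk>a \<in> carrier (dotg B); b \<in> carrier (dotg B); c \<in> carrier (dotg B)\<rbrakk> \<Longrightarrow>
      a \<otimes>\<^bsub>circg B\<^esub> (b \<otimes>\<^bsub>dotg B\<^esub> c) =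
        (a \<otimes>\<^bsub>circg B\<^esub> b) \<otimes>\<^bsub>dotg B\<^esub> inv\<^bsub>dotg B\<^esub> a \<otimes>\<^bsub>dotg B\<^esub> (a \<otimes>\<^bsub>circg B\<^esub> c)"

definition lam :: "'a brace_data \<Rightarrow> 'a \<Rightarrow> 'a \<Rightarrow> 'a" where
  "lam B a b = inv\<^bsub>dotg B\<^esub> a \<otimes>\<^bsub>dotg B\<^esub> (a \<otimes>\<^bsub>circg B\<^esub> b)"

text \<open>\<open>rho B b a\<close> is \<open>\<rho>\<^sub>b(a)\<close>.\<close>

definition rho :: "'a brace_data \<Rightarrow> 'a \<Rightarrow> 'a \<Rightarrow> 'a" where
  "rho B b a = inv\<^bsub>circg B\<^esub> (lam B a b) \<otimes>\<^bsub>circg B\<^esub> a \<otimes>\<^bsub>circg B\<^esub> b"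

definition assoc_solution :: "'a brace_data \<Rightarrow> 'a yb_data" where
  "assoc_solution B = \<lparr>pts = carrier (dotg B), sig = lam B, tau = rho B\<rparr>"

definition Soc :: "'a brace_data \<Rightarrow> 'a set" where
  "Soc B = {a \<in> carrier (dotg B). \<forall>b\<in>carrier (dotg B).
     a \<otimes>\<^bsub>circg B\<^esub> b = a \<otimes>\<^bsub>dotg B\<^esub> b \<and> a \<otimes>\<^bsub>dotg B\<^esub> b = b \<otimes>\<^bsub>dotg B\<^esub> a}"

text \<open>The two quotient groups have the same underlying set, because right cosets of the socle in
  the two groups coincide (lemma \<open>skew_left_brace_Soc_quot\<close> below).\<close>

definition Soc_quot :: "'a brace_data \<Rightarrow> 'a set brace_data" where
  "Soc_quot B = \<lparr>dotg = dotg B Mod Soc B, circg = circg B Mod Soc B\<rparr>"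

definition nilpotent_le_2 :: "'a brace_data \<Rightarrow> bool" where
  "nilpotent_le_2 B \<longleftrightarrow> card (carrier (dotg (Soc_quot (Soc_quot B)))) = 1"

definition opp_brace :: "'a brace_data \<Rightarrow> 'a brace_data" where
  "opp_brace B = B\<lparr>dotg := (dotg B)\<lparr>mult := (\<lambda>a b. b \<otimes>\<^bsub>dotg B\<^esub> a)\<rparr>\<rparr>"

context skew_left_brace
begin

abbreviation (input) A where "A \<equiv> carrier (dotg B)"
abbreviation (input) dmul (infixl \<open>\<cdot>\<close> 70) where "a \<cdot> b \<equiv> a \<otimes>\<^bsub>dotg B\<^esub> b"
abbreviation (input) cmul (infixl \<open>\<odot>\<close> 70) where "a \<odot> b \<equiv> a \<otimes>\<^bsub>circg B\<^esub> b"
abbreviation (input) dinv where "dinv a \<equiv> inv\<^bsub>dotg B\<^esub> a"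
abbreviation (input) cinv where "cinv a \<equiv> inv\<^bsub>circg B\<^esub> a"

lemma c_closed [simp, intro]: "\<lbrakk>a \<in> A; b \<in> A\<rbrakk> \<Longrightarrow> a \<odot> b \<in> A"
  using circ.m_closed carrier_eq by auto

lemma cinv_closed [simp, intro]: "a \<in> A \<Longrightarrow> cinv a \<in> A"
  using circ.inv_closed carrier_eq by auto

lemma one_eq: "\<one>\<^bsub>circg B\<^esub> = \<one>\<^bsub>dotg B\<^esub>"
proof -
  have [simp]: "\<one>\<^bsub>circg B\<^esub> \<in> A" using carrier_eq circ.one_closed by auto
  have "\<one>\<^bsub>circg B\<^esub> \<odot> (\<one>\<^bsub>dotg B\<^esub> \<cdot> \<one>\<^bsub>dotg B\<^esub>) =
    (\<one>\<^bsub>circg B\<^esub> \<odot> \<one>\<^bsub>dotg B\<^esub>) \<cdot> dinv \<one>\<^bsub>circg B\<^esub> \<cdot> (\<one>\<^bsub>circg B\<^esub> \<odot> \<one>\<^bsub>dotg B\<^esub>)"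
    by (rule brace_law) auto
  then have "\<one>\<^bsub>dotg B\<^esub> = dinv \<one>\<^bsub>circg B\<^esub>" using carrier_eq by simp
  then show ?thesis by (metis \<open>\<one>\<^bsub>circg B\<^esub> \<in> A\<close> dot.inv_inv dot.inv_one)
qed

lemma c_assoc: "\<lbrakk>a \<in> A; b \<in> A; c \<in> A\<rbrakk> \<Longrightarrow> a \<odot> b \<odot> c = a \<odot> (b \<odot> c)"
  using circ.m_assoc carrier_eq by auto

lemma lam_closed [simp, intro]: "\<lbrakk>a \<in> A; b \<in> A\<rbrakk> \<Longrightarrow> lam B a b \<in> A"
  by (simp add: lam_def)

lemma rho_closed [simp, intro]: "\<lbrakk>a \<in> A; b \<in> A\<rbrakk> \<Longrightarrow> rho B b a \<in> A"
  by (simp add: rho_def)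

lemma dot_lam: "\<lbrakk>a \<in> A; b \<in> A\<rbrakk> \<Longrightarrow> a \<cdot> lam B a b = a \<odot> b"
  by (simp add: lam_def dot.m_assoc[symmetric])

lemma lam_dot: "\<lbrakk>a \<in> A; b \<in> A; c \<in> A\<rbrakk> \<Longrightarrow> lam B a (b \<cdot> c) = lam B a b \<cdot> lam B a c"
  by (simp add: lam_def brace_law dot.m_assoc)

lemma lam_circ: 
  assumes "a \<in> A" "b \<in> A" "c \<in> A"
  shows "lam B (a \<odot> b) c = lam B a (lam B b c)"
proof -
  have "a \<cdot> lam B a b \<cdot> lam B a (lam B b c) = a \<cdot> lam B a (b \<cdot> lam B b c)"
    using assms by (simp add: lam_dot dot.m_assoc)
  also have "\<dots> = a \<odot> (b \<odot> c)" using assms by (simp add: dot_lam)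
  also have "\<dots> = (a \<odot> b) \<cdot> lam B (a \<odot> b) c" using assms by (simp add: dot_lam c_assoc)
  finally show ?thesis using assms by (simp add: dot_lam[of a b])
qed

lemma lam_one: "b \<in> A \<Longrightarrow> lam B \<one>\<^bsub>dotg B\<^esub> b = b"
  using circ.l_one[of b] by (simp add: lam_def one_eq carrier_eq)

lemma cinv_c: "a \<in> A \<Longrightarrow> cinv a \<odot> a = \<one>\<^bsub>dotg B\<^esub>" "a \<in> A \<Longrightarrow> a \<odot> cinv a = \<one>\<^bsub>dotg B\<^esub>"
  using carrier_eq one_eq by auto

lemma c_one: "a \<in> A \<Longrightarrow> \<one>\<^bsub>dotg B\<^esub> \<odot> a = a" "a \<in> A \<Longrightarrow> a \<odot> \<one>\<^bsub>dotg B\<^esub> = a"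
  using circ.l_one[of a] circ.r_one[of a] carrier_eq one_eq by auto

lemma c_cancel: "\<lbrakk>a \<in> A; b \<in> A\<rbrakk> \<Longrightarrow> a \<odot> (cinv a \<odot> b) = b" "\<lbrakk>a \<in> A; b \<in> A\<rbrakk> \<Longrightarrow> cinv a \<odot> (a \<odot> b) = b"
  by (simp_all add: c_assoc[symmetric] cinv_c c_one)

lemma lam_inv: "\<lbrakk>a \<in> A; b \<in> A\<rbrakk> \<Longrightarrow> lam B a (lam B (cinv a) b) = b"
  "\<lbrakk>a \<in> A; b \<in> A\<rbrakk> \<Longrightarrow> lam B (cinv a) (lam B a b) = b"
  by (simp_all add: lam_circ[symmetric] cinv_c lam_one)

lemma lam_rho: "\<lbrakk>a \<in> A; b \<in> A\<rbrakk> \<Longrightarrow> lam B a b \<odot> rho B b a = a \<odot> b"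
  by (simp add: rho_def c_assoc c_cancel)

lemma rho_circ:
  assumes "a \<in> A" "b \<in> A" "c \<in> A"
  shows "rho B (b \<odot> c) a = rho B c (rho B b a)"
proof -
  have "lam B a b \<odot> lam B (rho B b a) c = lam B a b \<cdot> lam B (lam B a b) (lam B (rho B b a) c)"
    using assms by (simp add: dot_lam)
  also have "\<dots> = lam B a b \<cdot> lam B a (lam B b c)"
    using assms by (simp add: lam_circ[symmetric] lam_rho)
  also have "\<dots> = lam B a (b \<odot> c)" using assms by (simp add: lam_dot[symmetric] dot_lam)
  finally have 1: "lam B a (b \<odot> c) = lam B a b \<odot> lam B (rho B b a) c" by simp
  have "lam B a (b \<odot> c) \<odot> rho B c (rho B b a) = lam B a b \<odot> (rho B b a \<odot> c)"
    using assms by (simp add: 1 c_assoc lam_rho)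
  also have "\<dots> = a \<odot> (b \<odot> c)" using assms by (simp add: c_assoc[symmetric] lam_rho)
  also have "\<dots> = lam B a (b \<odot> c) \<odot> rho B (b \<odot> c) a" using assms by (simp add: lam_rho)
  finally show ?thesis using assms by (metis c_cancel(2) c_closed lam_closed rho_closed)
qed

lemma rho_one: "a \<in> A \<Longrightarrow> rho B \<one>\<^bsub>dotg B\<^esub> a = a"
  using circ.inv_one by (simp add: rho_def lam_def c_one one_eq)

lemma rho_inv: "\<lbrakk>a \<in> A; b \<in> A\<rbrakk> \<Longrightarrow> rho B b (rho B (cinv b) a) = a"
  "\<lbrakk>a \<in> A; b \<in> A\<rbrakk> \<Longrightarrow> rho B (cinv b) (rho B b a) = a"
  by (simp_all add: rho_circ[symmetric] cinv_c rho_one)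

lemma yb_solution_assoc: "yb_solution (assoc_solution B)"
proof -
  have 1: "bij_betw (lam B a) A A" if "a \<in> A" for a
    by (rule bij_betw_byWitness[where f' = "lam B (cinv a)"]) (use that lam_inv in auto)
  have 2: "bij_betw (rho B a) A A" if "a \<in> A" for a
    by (rule bij_betw_byWitness[where f' = "rho B (cinv a)"]) (use that rho_inv in auto)
  have 3: "bij_betw (\<lambda>(a, b). (lam B a b, rho B b a)) (A \<times> A) (A \<times> A)"
  proof (rule bij_betw_byWitness[where
      f' = "\<lambda>(u, v). ((u \<odot> v) \<cdot> dinv u, cinv ((u \<odot> v) \<cdot> dinv u) \<odot> (u \<odot> v))"])
    have "(lam B a b \<odot> rho B b a) \<cdot> dinv (lam B a b) = a" if "a \<in> A" "b \<in> A" for a b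
      unfolding lam_rho[OF that] dot_lam[OF that, symmetric] using that by (simp add: dot.m_assoc)
    then show "\<forall>t\<in>A \<times> A. (case case t of (a, b) \<Rightarrow> (lam B a b, rho B b a) of
        (u, v) \<Rightarrow> ((u \<odot> v) \<cdot> dinv u, cinv ((u \<odot> v) \<cdot> dinv u) \<odot> (u \<odot> v))) = t"
      by (auto simp: lam_rho c_cancel)
    have L: "lam B ((u \<odot> v) \<cdot> dinv u) (cinv ((u \<odot> v) \<cdot> dinv u) \<odot> (u \<odot> v)) = u"
      if "u \<in> A" "v \<in> A" for u v
      using that by (simp add: lam_def c_cancel dot.inv_mult_group dot.m_assoc)
    have "rho B (cinv ((u \<odot> v) \<cdot> dinv u) \<odot> (u \<odot> v)) ((u \<odot> v) \<cdot> dinv u) = v"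
      if "u \<in> A" "v \<in> A" for u v
      unfolding rho_def L[OF that] using that by (simp add: c_cancel c_assoc)
    then show "\<forall>t\<in>A \<times> A. (case case t of (u, v) \<Rightarrow>
          ((u \<odot> v) \<cdot> dinv u, cinv ((u \<odot> v) \<cdot> dinv u) \<odot> (u \<odot> v)) of
        (a, b) \<Rightarrow> (lam B a b, rho B b a)) = t"
      by (auto simp: L)
  qed auto
  have 4: "yb_right (assoc_solution B) (yb_left (assoc_solution B) (yb_right (assoc_solution B) (a, b, c)))
    = yb_left (assoc_solution B) (yb_right (assoc_solution B) (yb_left (assoc_solution B) (a, b, c)))"
    if "a \<in> A" "b \<in> A" "c \<in> A" for a b c
  proof -
    let ?x = "lam B a (lam B b c)" and ?z = "rho B c (rho B b a)"
    let ?y = "lam B (rho B (lam B b c) a) (rho B c b)"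
    let ?y' = "rho B (lam B (rho B b a) c) (lam B a b)"
    have x: "lam B (lam B a b) (lam B (rho B b a) c) = ?x"
      using that by (simp add: lam_circ[symmetric] lam_rho)
    have z: "rho B (rho B c b) (rho B (lam B b c) a) = ?z"
      using that by (simp add: rho_circ[symmetric] lam_rho)
    have "?x \<odot> ?y \<odot> ?z = a \<odot> b \<odot> c"
      using that lam_rho[of "rho B (lam B b c) a" "rho B c b"] lam_rho[of a "lam B b c"]
        lam_rho[of b c] z by (metis c_assoc lam_closed rho_closed)
    moreover have "?x \<odot> ?y' \<odot> ?z = a \<odot> b \<odot> c"
      using that lam_rho[of "lam B a b" "lam B (rho B b a) c"] lam_rho[of a b]
        lam_rho[of "rho B b a" c] x by (metis c_assoc lam_closed rho_closed)
    ultimately have "?x \<odot> ?y \<odot> ?z = ?x \<odot> ?y' \<odot> ?z" by simp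
    then have "?y = ?y'"
      using that circ.r_cancel[of ?z "?x \<odot> ?y" "?x \<odot> ?y'"] circ.l_cancel[of ?x ?y ?y']
      by (simp add: carrier_eq)
    then show ?thesis
      using x z by (simp add: yb_left_def yb_right_def yb_map_def assoc_solution_def)
  qed
  show ?thesis unfolding yb_solution_def using 1 2 3 4
    by (auto simp: assoc_solution_def yb_map_def)
qed

lemma Soc_lam: "s \<in> Soc B \<longleftrightarrow> s \<in> A \<and> (\<forall>b\<in>A. lam B s b = b) \<and> (\<forall>b\<in>A. s \<cdot> b = b \<cdot> s)"
proof -
  have "s \<odot> b = s \<cdot> b \<longleftrightarrow> lam B s b = b" if "s \<in> A" "b \<in> A" for b
    using that by (simp flip: dot_lam)
  then show ?thesis unfolding Soc_def by blast
qed

lemma lam_Soc: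
  assumes "a \<in> A" "s \<in> Soc B" shows "lam B a s \<in> Soc B" "a \<odot> s \<odot> cinv a = lam B a s"
proof -
  have s: "s \<in> A" "\<And>b. b \<in> A \<Longrightarrow> lam B s b = b" "\<And>b. b \<in> A \<Longrightarrow> s \<cdot> b = b \<cdot> s"
    using assms(2) by (auto simp: Soc_lam)
  have c: "lam B a s \<cdot> b = b \<cdot> lam B a s" if "b \<in> A" for b
    using s assms(1) that lam_dot[of a s "lam B (cinv a) b"] lam_dot[of a "lam B (cinv a) b" s]
    by (simp add: lam_inv)
  have "a \<odot> s \<odot> cinv a = a \<odot> s \<cdot> lam B (a \<odot> s) (cinv a)" using assms s by (simp add: dot_lam)
  also have "\<dots> = a \<cdot> lam B a s \<cdot> lam B a (cinv a)" using assms s by (simp add: dot_lam lam_circ)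
  also have "\<dots> = lam B a s \<cdot> (a \<cdot> lam B a (cinv a))"
    using assms s c[of a] by (simp flip: dot.m_assoc)
  also have "\<dots> = lam B a s" using assms s by (simp add: dot_lam cinv_c)
  finally show e: "a \<odot> s \<odot> cinv a = lam B a s" .
  show "lam B a s \<in> Soc B"
    using c s assms(1) by (auto simp: Soc_lam lam_inv lam_circ simp flip: e)
qed

lemma Soc_circ: "\<lbrakk>s \<in> Soc B; b \<in> A\<rbrakk> \<Longrightarrow> s \<odot> b = s \<cdot> b"
  by (simp add: Soc_def)

lemma one_Soc: "\<one>\<^bsub>dotg B\<^esub> \<in> Soc B"
  by (simp add: Soc_lam lam_one)

lemma mult_Soc: "\<lbrakk>s \<in> Soc B; t \<in> Soc B\<rbrakk> \<Longrightarrow> s \<cdot> t \<in> Soc B"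
proof -
  assume s: "s \<in> Soc B" and t: "t \<in> Soc B"
  then have st: "s \<in> A" "t \<in> A" by (auto simp: Soc_def)
  have "lam B (s \<cdot> t) b = b" if "b \<in> A" for b
  proof -
    have "lam B (s \<cdot> t) b = lam B s (lam B t b)"
      using lam_circ[of s t b] Soc_circ[OF s st(2)] st that by simp
    moreover have "lam B t b = b" "lam B s b = b" using s t that Soc_lam by blast+
    ultimately show ?thesis by simp
  qed
  moreover have "s \<cdot> t \<cdot> b = b \<cdot> (s \<cdot> t)" if b: "b \<in> A" for b
  proof -
    have "t \<cdot> b = b \<cdot> t" using t b Soc_lam by blast
    then have "s \<cdot> t \<cdot> b = s \<cdot> (b \<cdot> t)" using st b by (simp add: dot.m_assoc)
    also have "\<dots> = s \<cdot> b \<cdot> t" using st b by (simp add: dot.m_assoc)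
    also have "s \<cdot> b = b \<cdot> s" using s b Soc_lam by blast
    finally show ?thesis using st b by (simp add: dot.m_assoc)
  qed
  ultimately show ?thesis using st by (simp add: Soc_lam)
qed

lemma inv_Soc: assumes "s \<in> Soc B" shows "dinv s \<in> Soc B" "cinv s = dinv s"
proof -
  have s: "s \<in> A" "\<And>b. b \<in> A \<Longrightarrow> lam B s b = b" "\<And>b. b \<in> A \<Longrightarrow> s \<cdot> b = b \<cdot> s"
    using assms by (auto simp: Soc_lam)
  have "s \<cdot> cinv s = \<one>\<^bsub>dotg B\<^esub>" using s Soc_circ[OF assms, of "cinv s"] cinv_c(2) by simp
  then show e: "cinv s = dinv s"
    using s by (metis cinv_closed dot.inv_closed dot.l_cancel dot.r_inv)
  have "lam B (dinv s) b = b" if "b \<in> A" for b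
    using s that lam_inv(2)[of s b] by (simp add: e)
  moreover have "dinv s \<cdot> b = b \<cdot> dinv s" if "b \<in> A" for b
    using s that by (metis dot.inv_closed dot.inv_solve_left dot.inv_solve_right dot.m_assoc dot.m_closed)
  ultimately show "dinv s \<in> Soc B" using s by (simp add: Soc_lam)
qed

lemma Soc_normal: "Soc B \<lhd> dotg B" "Soc B \<lhd> circg B"
proof -
  have "subgroup (Soc B) (dotg B)"
    by (rule subgroup.intro) (auto simp: mult_Soc one_Soc inv_Soc, auto simp: Soc_def)
  moreover have "x \<cdot> s \<cdot> dinv x \<in> Soc B" if "x \<in> A" "s \<in> Soc B" for x s
  proof -
    have "s \<in> A" "x \<cdot> s = s \<cdot> x" using that by (auto simp: Soc_lam)
    then show ?thesis using that by (simp add: dot.m_assoc)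
  qed
  ultimately show "Soc B \<lhd> dotg B" by (simp add: dot.normal_inv_iff)
  have A: "s \<in> A" if "s \<in> Soc B" for s using that by (simp add: Soc_def)
  have "subgroup (Soc B) (circg B)"
    by (rule subgroup.intro) (auto simp: mult_Soc one_Soc inv_Soc Soc_circ one_eq carrier_eq A)
  then show "Soc B \<lhd> circg B" by (simp add: circ.normal_inv_iff lam_Soc carrier_eq)
qed

lemma Soc_coset: "x \<in> A \<Longrightarrow> Soc B #>\<^bsub>circg B\<^esub> x = Soc B #>\<^bsub>dotg B\<^esub> x"
  by (simp add: r_coset_def Soc_circ)

lemma skew_left_brace_Soc_quot: "skew_left_brace (Soc_quot B)"
proof -
  interpret N: normal "Soc B" "dotg B" by (rule Soc_normal)
  interpret M: normal "Soc B" "circg B" by (rule Soc_normal)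
  have ca: "carrier (dotg (Soc_quot B)) = (\<lambda>a. Soc B #>\<^bsub>dotg B\<^esub> a) ` A"
    by (auto simp: Soc_quot_def FactGroup_def RCOSETS_def)
  have cd: "(Soc B #>\<^bsub>dotg B\<^esub> a) \<otimes>\<^bsub>dotg (Soc_quot B)\<^esub> (Soc B #>\<^bsub>dotg B\<^esub> b) = Soc B #>\<^bsub>dotg B\<^esub> (a \<cdot> b)"
    if "a \<in> A" "b \<in> A" for a b
    using that by (simp add: Soc_quot_def FactGroup_def N.rcos_sum)
  have cc: "(Soc B #>\<^bsub>dotg B\<^esub> a) \<otimes>\<^bsub>circg (Soc_quot B)\<^esub> (Soc B #>\<^bsub>dotg B\<^esub> b) = Soc B #>\<^bsub>dotg B\<^esub> (a \<odot> b)"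
    if "a \<in> A" "b \<in> A" for a b
    using that M.rcos_sum[of a b] by (simp add: Soc_quot_def FactGroup_def Soc_coset carrier_eq)
  have ci: "inv\<^bsub>dotg (Soc_quot B)\<^esub> (Soc B #>\<^bsub>dotg B\<^esub> a) = Soc B #>\<^bsub>dotg B\<^esub> (dinv a)"
    if "a \<in> A" for a
    using that N.inv_FactGroup[of "Soc B #>\<^bsub>dotg B\<^esub> a"] N.rcos_inv[of a]
    by (auto simp: Soc_quot_def FactGroup_def RCOSETS_def)
  have gd: "group (dotg (Soc_quot B))" and gc: "group (circg (Soc_quot B))"
    by (simp_all add: Soc_quot_def N.factorgroup_is_group M.factorgroup_is_group)
  have eq: "carrier (circg (Soc_quot B)) = carrier (dotg (Soc_quot B))"
    by (auto simp: Soc_quot_def FactGroup_def RCOSETS_def Soc_coset carrier_eq)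
  have law: "P \<otimes>\<^bsub>circg (Soc_quot B)\<^esub> (Q \<otimes>\<^bsub>dotg (Soc_quot B)\<^esub> R) =
      (P \<otimes>\<^bsub>circg (Soc_quot B)\<^esub> Q) \<otimes>\<^bsub>dotg (Soc_quot B)\<^esub> inv\<^bsub>dotg (Soc_quot B)\<^esub> P
        \<otimes>\<^bsub>dotg (Soc_quot B)\<^esub> (P \<otimes>\<^bsub>circg (Soc_quot B)\<^esub> R)"
    if PQR: "P \<in> carrier (dotg (Soc_quot B))" "Q \<in> carrier (dotg (Soc_quot B))"
      "R \<in> carrier (dotg (Soc_quot B))" for P Q R
  proof -
    obtain a b c where "a \<in> A" "b \<in> A" "c \<in> A" "P = Soc B #>\<^bsub>dotg B\<^esub> a"
      "Q = Soc B #>\<^bsub>dotg B\<^esub> b" "R = Soc B #>\<^bsub>dotg B\<^esub> c" using PQR unfolding ca by blast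
    then show ?thesis by (simp add: cd cc ci brace_law)
  qed
  show ?thesis
    by (intro skew_left_brace.intro skew_left_brace_axioms.intro gd gc eq) (rule law)
qed

lemma skew_left_brace_opp: "skew_left_brace (opp_brace B)"
proof -
  let ?G = "(dotg B)\<lparr>mult := (\<lambda>a b. b \<cdot> a)\<rparr>"
  have g: "group ?G"
    by (rule groupI) (auto simp: dot.m_assoc intro: dot.r_inv dot.inv_closed)
  interpret G: group ?G by (rule g)
  have inv: "inv\<^bsub>?G\<^esub> a = dinv a" if "a \<in> A" for a
    by (rule G.inv_equality) (use that in auto)
  show ?thesis
    by (intro skew_left_brace.intro skew_left_brace_axioms.intro)
      (simp_all add: opp_brace_def g circ.group_axioms carrier_eq inv brace_law dot.m_assoc)
qed

end

end

theory Submission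
  imports Defs
begin

text \<open>The socle is the set of all \<open>s\<close> for which \<open>\<lambda>\<^sub>s\<close> and \<open>\<rho>\<^sub>s\<close> are both the identity, so the
  classes of the retraction relation \<open>\<approx>\<close> are exactly the cosets of the socle, and \<open>\<approx>\<close> is a
  congruence of both groups. Nilpotency of class at most 2 says that every element of
  \<open>B / Soc B\<close> lies in its socle, i.e. \<open>a \<cdot> b \<approx> b \<cdot> a \<approx> a \<circ> b\<close>; this is (ii), and it is symmetric
  under passing to the opposite brace. Both 2-reductivity and multipermutation level at most 2 say
  \<open>\<lambda>\<^sub>a(b) \<approx> b\<close> and \<open>\<rho>\<^sub>a(b) \<approx> b\<close>. These relations are equivalent to (ii) by cancellation in the
  identities \<open>a \<cdot> \<lambda>\<^sub>a(b) = a \<circ> b = \<lambda>\<^sub>a(b) \<circ> \<rho>\<^sub>b(a)\<close>.\<close>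

section \<open>Trivial quotients and cancellation of cosets\<close>

lemma card_quotient_eq_1_iff:
  assumes r: "equiv M r" and "M \<noteq> {}"
  shows "card (M // r) = 1 \<longleftrightarrow> (\<forall>x\<in>M. \<forall>y\<in>M. (x, y) \<in> r)"
proof
  assume "card (M // r) = 1"
  then obtain C where C: "M // r = {C}" by (auto simp: card_1_singleton_iff)
  show "\<forall>x\<in>M. \<forall>y\<in>M. (x, y) \<in> r"
  proof (intro ballI)
    fix x y assume xy: "x \<in> M" "y \<in> M"
    then have "r `` {x} = r `` {y}" using C quotientI[of x M r] quotientI[of y M r] by simp
    then show "(x, y) \<in> r" using xy r by (simp add: eq_equiv_class_iff)
  qed
next
  assume all: "\<forall>x\<in>M. \<forall>y\<in>M. (x, y) \<in> r"
  obtain x where x: "x \<in> M" using assms(2) by blast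
  have "M // r = {r `` {x}}"
  proof -
    have "r `` {y} = r `` {x}" if "y \<in> M" for y
      using all x that equiv_class_eq[OF r] by blast
    then show ?thesis using x unfolding quotient_def by blast
  qed
  then show "card (M // r) = 1" by simp
qed

lemma (in group) card_FactGroup_eq_1_iff:
  assumes "subgroup H G"
  shows "card (carrier (G Mod H)) = 1 \<longleftrightarrow> H = carrier G"
proof
  assume "card (carrier (G Mod H)) = 1"
  then obtain C where "rcosets H = {C}" by (auto simp: FactGroup_def card_1_singleton_iff)
  moreover have "H \<in> rcosets H" using assms subgroup.subgroup_in_rcosets is_group by blast
  moreover have "\<Union>(rcosets H) = carrier G" by (rule rcosets_part_G[OF assms])
  ultimately show "H = carrier G" by simp
next
  assume H: "H = carrier G"
  have "rcosets H = {carrier G}"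
    using coset_join2[OF _ assms] by (auto simp: RCOSETS_def H)
  then show "card (carrier (G Mod H)) = 1" by (simp add: FactGroup_def)
qed

text \<open>Cancellation in the factor group, read on representatives. It serves both group
  structures, since the socle is normal in each.\<close>

lemma (in normal) rcos_l_cancel:
  assumes "x \<in> carrier G" "y \<in> carrier G" "z \<in> carrier G"
  shows "H #> (z \<otimes> x) = H #> (z \<otimes> y) \<longleftrightarrow> H #> x = H #> y"
proof -
  interpret F: group "G Mod H" by (rule factorgroup_is_group)
  have "H #> u \<in> carrier (G Mod H)" if "u \<in> carrier G" for u
    using that by (auto simp: FactGroup_def RCOSETS_def)
  then show ?thesis
    using F.l_cancel[of "H #> z" "H #> x" "H #> y"] assms
    by (simp flip: rcos_sum) (auto simp: FactGroup_def)
qed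

section \<open>2-reductivity and the double retraction of a solution\<close>

text \<open>The four identities pair up by their inner value: two of them relate
  \<open>sig S x y\<close> to \<open>y\<close>, the other two \<open>tau S x y\<close> to
  \<open>y\<close>.\<close>

lemma two_reductive_iff:
  assumes S: "yb_solution S"
  shows "two_reductive S \<longleftrightarrow>
    (\<forall>x\<in>pts S. \<forall>y\<in>pts S. (sig S x y, y) \<in> ret_rel S \<and> (tau S x y, y) \<in> ret_rel S)"
  using yb_solution_closed[OF S] unfolding two_reductive_def ret_rel_def by auto

text \<open>Without a point acting trivially, level at most 2 would not imply 2-reductivity.\<close>

lemma mpl_le_2_iff_two_reductive:
  assumes S: "yb_solution S" and e: "e \<in> pts S"
    and e_id: "\<And>x. x \<in> pts S \<Longrightarrow> sig S e x = x" "\<And>x. x \<in> pts S \<Longrightarrow> tau S e x = x"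
  shows "mpl_le_2 S \<longleftrightarrow> two_reductive S"
proof -
  let ?R = "ret_rel S"
  have P: "pts (Ret S) = (\<lambda>x. ?R `` {x}) ` pts S"
    by (auto simp: Ret_def quotient_def)
  have ret: "(?R `` {x}, ?R `` {y}) \<in> ret_rel (Ret S) \<longleftrightarrow>
      (\<forall>z\<in>pts S. (sig S x z, sig S y z) \<in> ?R \<and> (tau S x z, tau S y z) \<in> ?R)"
    if "x \<in> pts S" "y \<in> pts S" for x y
    using that yb_solution_closed[OF S]
    by (simp add: ret_rel_def[of "Ret S"] P sig_Ret[OF S] tau_Ret[OF S]
        eq_equiv_class_iff[OF equiv_ret_rel])
  have "mpl_le_2 S \<longleftrightarrow> card (pts (Ret S) // ret_rel (Ret S)) = 1"
    by (simp add: mpl_le_2_def Ret_def[of "Ret S"])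
  also have "\<dots> \<longleftrightarrow> (\<forall>p\<in>pts (Ret S). \<forall>q\<in>pts (Ret S). (p, q) \<in> ret_rel (Ret S))"
    using e by (intro card_quotient_eq_1_iff equiv_ret_rel) (auto simp: P)
  also have "\<dots> \<longleftrightarrow> (\<forall>x\<in>pts S. \<forall>y\<in>pts S. \<forall>z\<in>pts S.
      (sig S x z, sig S y z) \<in> ?R \<and> (tau S x z, tau S y z) \<in> ?R)"
    by (simp add: P ret)
  also have "\<dots> \<longleftrightarrow> (\<forall>x\<in>pts S. \<forall>z\<in>pts S. (sig S x z, z) \<in> ?R \<and> (tau S x z, z) \<in> ?R)"
    (is "?all \<longleftrightarrow> ?triv")
  proof
    \<comment> \<open>Comparing \<open>x\<close> with \<open>e\<close>, whose maps are the identity,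
      puts \<open>z\<close> itself in second place.\<close>
    assume ?all then show ?triv using e e_id by (metis (full_types))
  next
    assume ?triv then show ?all
      using equiv_ret_rel[of S] by (meson equivE symE transE)
  qed
  finally show ?thesis by (simp add: two_reductive_iff[OF S])
qed

section \<open>The socle and the retraction relation of a brace\<close>

context skew_left_brace
begin

text \<open>Once \<open>lam B s\<close> is trivial, \<open>rho B s\<close> fixes \<open>a\<close>
  iff \<open>s\<close> commutes with \<open>dinv (cinv a)\<close>. As \<open>a\<close> varies this
  element runs through all of \<open>A\<close>, so trivial \<open>rho B s\<close> means that
  \<open>s\<close> is central in the dot group.\<close>

lemma Soc_lam_rho:
  "s \<in> Soc B \<longleftrightarrow> s \<in> A \<and> (\<forall>b\<in>A. lam B s b = b) \<and> (\<forall>b\<in>A. rho B s b = b)"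
proof -
  have "(\<forall>b\<in>A. s \<cdot> b = b \<cdot> s) \<longleftrightarrow> (\<forall>b\<in>A. rho B s b = b)"
    if s: "s \<in> A" and l: "\<forall>b\<in>A. lam B s b = b"
  proof -
    have rho: "rho B s a = a \<longleftrightarrow> s \<cdot> dinv (cinv a) = dinv (cinv a) \<cdot> s" if a: "a \<in> A" for a
    proof -
      let ?t = "lam B a s"
      have t: "?t \<in> A" using a s by simp
      have a_lam: "a \<cdot> lam B a (cinv a) = \<one>\<^bsub>dotg B\<^esub>" using a by (simp add: dot_lam cinv_c)
      have "a \<odot> s \<odot> cinv a = a \<odot> s \<cdot> lam B (a \<odot> s) (cinv a)" using a s by (simp add: dot_lam)
      also have "\<dots> = a \<cdot> ?t \<cdot> lam B a (cinv a)" using a s l by (simp add: dot_lam lam_circ)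
      \<comment> \<open>The circle conjugate of \<open>s\<close> by \<open>a\<close> is the dot
        conjugate of \<open>?t\<close> by \<open>a\<close>, because \<open>lam B a (cinv a)\<close>
        is the dot inverse of \<open>a\<close>.\<close>
      finally have conj: "a \<odot> s \<odot> cinv a \<cdot> a = a \<cdot> ?t"
        using a t a_lam dot.inv_equality[of a "lam B a (cinv a)"] dot.inv_comm[OF a_lam]
        by (simp add: dot.m_assoc)
      have "rho B s a = a \<longleftrightarrow> ?t \<odot> rho B s a = ?t \<odot> a"
        using a s t by (metis c_cancel(2) rho_closed)
      also have "\<dots> \<longleftrightarrow> a \<odot> s = ?t \<odot> a" using a s by (simp add: lam_rho)
      also have "\<dots> \<longleftrightarrow> a \<odot> s \<odot> cinv a = ?t"
        using a s t by (metis c_assoc c_closed c_one(2) cinv_c cinv_closed)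
      also have "\<dots> \<longleftrightarrow> a \<odot> s \<odot> cinv a \<cdot> a = ?t \<cdot> a"
        using a s t by (simp add: dot.r_cancel)
      also have "\<dots> \<longleftrightarrow> ?t \<cdot> a = a \<cdot> ?t" unfolding conj by auto
      \<comment> \<open>The dot automorphism \<open>lam B (cinv a)\<close> carries \<open>?t\<close>
        back to \<open>s\<close>.\<close>
      also have "\<dots> \<longleftrightarrow> lam B (cinv a) (?t \<cdot> a) = lam B (cinv a) (a \<cdot> ?t)"
        using a t by (metis lam_inv(1) dot.m_closed)
      also have "\<dots> \<longleftrightarrow> s \<cdot> lam B (cinv a) a = lam B (cinv a) a \<cdot> s"
        using a s t by (simp add: lam_dot lam_inv)
      also have "lam B (cinv a) a = dinv (cinv a)" using a by (simp add: lam_def cinv_c)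
      finally show ?thesis .
    qed
    show ?thesis
    proof
      assume com: "\<forall>b\<in>A. s \<cdot> b = b \<cdot> s"
      then show "\<forall>b\<in>A. rho B s b = b" by (simp add: rho)
    next
      assume *: "\<forall>b\<in>A. rho B s b = b"
      show "\<forall>b\<in>A. s \<cdot> b = b \<cdot> s"
      proof
        fix b assume "b \<in> A"
        then show "s \<cdot> b = b \<cdot> s"
          using rho[of "cinv (dinv b)"] * circ.inv_inv[of "dinv b"] by (simp add: carrier_eq)
      qed
    qed
  qed
  then show ?thesis unfolding Soc_lam by blast
qed

text \<open>Equal cosets mean that \<open>x \<odot> cinv y\<close> lies in the socle, so acts
  trivially. Since \<open>lam\<close> is a homomorphism on the circle group and \<open>rho\<close>
  an antihomomorphism, this says that \<open>x\<close> and \<open>y\<close> act alike.\<close>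

lemma ret_rel_assoc_solution:
  assumes "x \<in> A" "y \<in> A"
  shows "(x, y) \<in> ret_rel (assoc_solution B) \<longleftrightarrow> Soc B #>\<^bsub>dotg B\<^esub> x = Soc B #>\<^bsub>dotg B\<^esub> y"
proof -
  interpret M: normal "Soc B" "circg B" by (rule Soc_normal)
  have "Soc B #>\<^bsub>dotg B\<^esub> x = Soc B #>\<^bsub>dotg B\<^esub> y \<longleftrightarrow> x \<odot> cinv y \<in> Soc B"
    using circ.rcos_self[of x "Soc B"] M.rcos_module[of y x] circ.repr_independence[of x "Soc B" y]
      M.subgroup_axioms assms by (auto simp: carrier_eq simp flip: Soc_coset)
  also have "\<dots> \<longleftrightarrow> (\<forall>z\<in>A. lam B x (lam B (cinv y) z) = z) \<and> (\<forall>z\<in>A. rho B (cinv y) (rho B x z) = z)"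
    using assms by (simp add: Soc_lam_rho lam_circ rho_circ)
  also have "\<dots> \<longleftrightarrow> (\<forall>z\<in>A. lam B x z = lam B y z) \<and> (\<forall>z\<in>A. rho B x z = rho B y z)"
    using assms by (metis lam_inv rho_inv lam_closed rho_closed cinv_closed)
  also have "\<dots> \<longleftrightarrow> (x, y) \<in> ret_rel (assoc_solution B)"
    using assms by (auto simp: ret_rel_def assoc_solution_def)
  finally show ?thesis by simp
qed

lemma Soc_coset_l_cancel:
  assumes "x \<in> A" "y \<in> A" "z \<in> A"
  shows "Soc B #>\<^bsub>dotg B\<^esub> (z \<cdot> x) = Soc B #>\<^bsub>dotg B\<^esub> (z \<cdot> y) \<longleftrightarrow>
      Soc B #>\<^bsub>dotg B\<^esub> x = Soc B #>\<^bsub>dotg B\<^esub> y"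
    and "Soc B #>\<^bsub>dotg B\<^esub> (z \<odot> x) = Soc B #>\<^bsub>dotg B\<^esub> (z \<odot> y) \<longleftrightarrow>
      Soc B #>\<^bsub>dotg B\<^esub> x = Soc B #>\<^bsub>dotg B\<^esub> y"
  using assms normal.rcos_l_cancel[OF Soc_normal(1), of x y z]
    normal.rcos_l_cancel[OF Soc_normal(2), of x y z]
  by (simp_all add: carrier_eq Soc_coset)

lemma Soc_coset_circ:
  assumes "x \<in> A" "y \<in> A"
  shows "(Soc B #>\<^bsub>dotg B\<^esub> x) <#>\<^bsub>circg B\<^esub> (Soc B #>\<^bsub>dotg B\<^esub> y) = Soc B #>\<^bsub>dotg B\<^esub> (x \<odot> y)"
  using assms normal.rcos_sum[OF Soc_normal(2), of x y] by (simp add: carrier_eq Soc_coset)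

section \<open>Nilpotency of class at most 2, also for the opposite brace\<close>

lemma nilpotent_le_2_iff:
  "nilpotent_le_2 B \<longleftrightarrow> (\<forall>a\<in>A. \<forall>b\<in>A.
    Soc B #>\<^bsub>dotg B\<^esub> (a \<odot> b) = Soc B #>\<^bsub>dotg B\<^esub> (a \<cdot> b) \<and>
    Soc B #>\<^bsub>dotg B\<^esub> (a \<cdot> b) = Soc B #>\<^bsub>dotg B\<^esub> (b \<cdot> a))"
proof -
  interpret Q: skew_left_brace "Soc_quot B" by (rule skew_left_brace_Soc_quot)
  interpret N: normal "Soc B" "dotg B" by (rule Soc_normal)
  have C: "carrier (dotg (Soc_quot B)) = (\<lambda>a. Soc B #>\<^bsub>dotg B\<^esub> a) ` A"
    by (auto simp: Soc_quot_def FactGroup_def RCOSETS_def)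
  have "nilpotent_le_2 B \<longleftrightarrow> Soc (Soc_quot B) = carrier (dotg (Soc_quot B))"
    using Q.dot.card_FactGroup_eq_1_iff[OF normal_imp_subgroup[OF Q.Soc_normal(1)]]
    by (simp add: nilpotent_le_2_def Soc_quot_def[of "Soc_quot B"])
  also have "\<dots> \<longleftrightarrow> (\<forall>P\<in>carrier (dotg (Soc_quot B)). \<forall>Q\<in>carrier (dotg (Soc_quot B)).
      P \<otimes>\<^bsub>circg (Soc_quot B)\<^esub> Q = P \<otimes>\<^bsub>dotg (Soc_quot B)\<^esub> Q \<and>
      P \<otimes>\<^bsub>dotg (Soc_quot B)\<^esub> Q = Q \<otimes>\<^bsub>dotg (Soc_quot B)\<^esub> P)"
    unfolding Soc_def by blast
  also have "\<dots> \<longleftrightarrow> (\<forall>a\<in>A. \<forall>b\<in>A.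
    Soc B #>\<^bsub>dotg B\<^esub> (a \<odot> b) = Soc B #>\<^bsub>dotg B\<^esub> (a \<cdot> b) \<and>
    Soc B #>\<^bsub>dotg B\<^esub> (a \<cdot> b) = Soc B #>\<^bsub>dotg B\<^esub> (b \<cdot> a))"
    unfolding C by (simp add: Soc_quot_def FactGroup_def N.rcos_sum Soc_coset_circ)
  finally show ?thesis .
qed

text \<open>Swapping dot factors preserves the socle, where both products agree with the circle
  product. The coset criterion then only exchanges \<open>a \<cdot> b\<close> and
  \<open>b \<cdot> a\<close>.\<close>

lemma nilpotent_le_2_opp: "nilpotent_le_2 (opp_brace B) \<longleftrightarrow> nilpotent_le_2 B"
proof -
  have Soc: "Soc (opp_brace B) = Soc B"
    unfolding Soc_def opp_brace_def by (intro Collect_cong) (simp, metis)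
  \<comment> \<open>A right coset of the opposite group is a left coset of the original one; these
    agree because the socle is central.\<close>
  have coset: "Soc B #>\<^bsub>dotg (opp_brace B)\<^esub> x = Soc B #>\<^bsub>dotg B\<^esub> x" if "x \<in> A" for x
  proof -
    have "x \<cdot> s = s \<cdot> x" if "s \<in> Soc B" for s using that \<open>x \<in> A\<close> Soc_lam by metis
    then show ?thesis unfolding r_coset_def opp_brace_def by (intro SUP_cong) simp_all
  qed
  show ?thesis
    unfolding skew_left_brace.nilpotent_le_2_iff[OF skew_left_brace_opp] nilpotent_le_2_iff Soc
    by (simp add: coset opp_brace_def) (auto simp: coset[unfolded opp_brace_def, simplified])
qed

section \<open>2-reductivity as a condition on socle cosets\<close>

lemma two_reductive_assoc_iff:
  "two_reductive (assoc_solution B) \<longleftrightarrow> (\<forall>a\<in>A. \<forall>b\<in>A.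
    Soc B #>\<^bsub>dotg B\<^esub> (a \<odot> b) = Soc B #>\<^bsub>dotg B\<^esub> (a \<cdot> b) \<and>
    Soc B #>\<^bsub>dotg B\<^esub> (a \<cdot> b) = Soc B #>\<^bsub>dotg B\<^esub> (b \<cdot> a))"
proof -
  let ?q = "\<lambda>x. Soc B #>\<^bsub>dotg B\<^esub> x"
  have circ_cong: "?q (x \<odot> z) = ?q (x' \<odot> z)" if "x \<in> A" "x' \<in> A" "z \<in> A" "?q x = ?q x'" for x x' z
    using that by (simp flip: Soc_coset_circ)
  have "two_reductive (assoc_solution B) \<longleftrightarrow>
      (\<forall>x\<in>A. \<forall>y\<in>A. ?q (lam B x y) = ?q y \<and> ?q (rho B x y) = ?q y)"
    using two_reductive_iff[OF yb_solution_assoc]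
    by (simp add: ret_rel_assoc_solution[symmetric] lam_closed rho_closed assoc_solution_def)
  also have "\<dots> \<longleftrightarrow> (\<forall>a\<in>A. \<forall>b\<in>A. ?q (a \<odot> b) = ?q (a \<cdot> b) \<and> ?q (a \<cdot> b) = ?q (b \<cdot> a))"
    (is "?red \<longleftrightarrow> ?comm")
  proof
    assume red: ?red
    have 1: "?q (a \<odot> b) = ?q (a \<cdot> b)" if ab: "a \<in> A" "b \<in> A" for a b
      using Soc_coset_l_cancel(1)[of "lam B a b" b a] red ab by (simp add: dot_lam)
    \<comment> \<open>In \<open>lam B a b \<odot> rho B b a = a \<odot> b\<close> the factors are
      replaced, one at a time, by \<open>b\<close> and \<open>a\<close>. With \<open>1\<close> this
      also makes the dot product commutative modulo the socle.\<close>
    have "?q (a \<odot> b) = ?q (b \<odot> a)" if ab: "a \<in> A" "b \<in> A" for a b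
    proof -
      have "?q (lam B a b \<odot> rho B b a) = ?q (b \<odot> rho B b a)"
        using red ab by (intro circ_cong) auto
      also have "\<dots> = ?q (b \<odot> a)"
        using red ab by (simp add: Soc_coset_l_cancel)
      finally show ?thesis using ab by (simp add: lam_rho)
    qed
    with 1 show ?comm by simp
  next
    assume comm: ?comm
    have l: "?q (lam B a b) = ?q b" if ab: "a \<in> A" "b \<in> A" for a b
      using Soc_coset_l_cancel(1)[of "lam B a b" b a] comm ab by (simp add: dot_lam)
    \<comment> \<open>The same identity in reverse: modulo the socle the product is
      \<open>b \<odot> a\<close>, hence \<open>lam B a b \<odot> a\<close>, and the left factor
      cancels.\<close>
    have "?q (rho B b a) = ?q a" if ab: "a \<in> A" "b \<in> A" for a b
    proof -
      have "?q (lam B a b \<odot> rho B b a) = ?q (b \<odot> a)" using comm ab by (simp add: lam_rho)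
      also have "\<dots> = ?q (lam B a b \<odot> a)"
        using l ab by (intro circ_cong) auto
      finally show ?thesis using ab by (simp add: Soc_coset_l_cancel)
    qed
    with l show ?red by simp
  qed
  finally show ?thesis .
qed

end

theorem theorem6p4:
  fixes B :: "'a brace_data"
  assumes "skew_left_brace B"
  shows "(two_reductive (assoc_solution B) \<longleftrightarrow>
      (\<forall>a\<in>carrier (dotg B). \<forall>b\<in>carrier (dotg B). \<forall>c\<in>carrier (dotg B).
        lam B (a \<otimes>\<^bsub>dotg B\<^esub> b) c = lam B (b \<otimes>\<^bsub>dotg B\<^esub> a) c \<and>
        lam B (b \<otimes>\<^bsub>dotg B\<^esub> a) c = lam B (a \<otimes>\<^bsub>circg B\<^esub> b) c \<and>
        rho B (a \<otimes>\<^bsub>dotg B\<^esub> b) c = rho B (b \<otimes>\<^bsub>dotg B\<^esub> a) c \<and>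
        rho B (b \<otimes>\<^bsub>dotg B\<^esub> a) c = rho B (a \<otimes>\<^bsub>circg B\<^esub> b) c))
    \<and> (two_reductive (assoc_solution B) \<longleftrightarrow> mpl_le_2 (assoc_solution B))
    \<and> (two_reductive (assoc_solution B) \<longleftrightarrow> nilpotent_le_2 B)
    \<and> (two_reductive (assoc_solution B) \<longleftrightarrow> nilpotent_le_2 (opp_brace B))"
proof -
  interpret skew_left_brace B by (rule assms)
  let ?S = "assoc_solution B" and ?q = "\<lambda>x. Soc B #>\<^bsub>dotg B\<^esub> x"
  have mpl: "mpl_le_2 ?S \<longleftrightarrow> two_reductive ?S"
    \<comment> \<open>The neutral element is the point that acts trivially.\<close>
    by (rule mpl_le_2_iff_two_reductive[OF yb_solution_assoc, of "\<one>\<^bsub>dotg B\<^esub>"])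
      (auto simp: assoc_solution_def lam_one rho_one)
  have q: "?q x = ?q y \<longleftrightarrow> (\<forall>z\<in>A. lam B x z = lam B y z \<and> rho B x z = rho B y z)"
    if "x \<in> A" "y \<in> A" for x y
    using that by (simp flip: ret_rel_assoc_solution) (simp add: ret_rel_def assoc_solution_def)
  have "two_reductive ?S \<longleftrightarrow>
      (\<forall>a\<in>A. \<forall>b\<in>A. ?q (a \<cdot> b) = ?q (b \<cdot> a) \<and> ?q (b \<cdot> a) = ?q (a \<odot> b))"
    unfolding two_reductive_assoc_iff by (intro ball_cong) auto
  then have "two_reductive ?S \<longleftrightarrow> (\<forall>a\<in>A. \<forall>b\<in>A. \<forall>c\<in>A.
      lam B (a \<cdot> b) c = lam B (b \<cdot> a) c \<and> lam B (b \<cdot> a) c = lam B (a \<odot> b) c \<and>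
      rho B (a \<cdot> b) c = rho B (b \<cdot> a) c \<and> rho B (b \<cdot> a) c = rho B (a \<odot> b) c)"
    by (simp add: q ball_conj_distrib conj_ac)
  with mpl show ?thesis
    by (simp only: nilpotent_le_2_opp nilpotent_le_2_iff two_reductive_assoc_iff)
qed

end
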